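(* Let $n_1,n_2$ be positive integers and $n=\min\{n_1,n_2\}$. Let $f\in\mathcal{A}_{n_1}$ and $g\in\mathcal{A}_{n_2}\cap\mathcal{S}^{*}$. Let $\beta\ge0$, $\gamma\ge0$ be real with $\beta+\gamma>0$, let $0<\mu\le1$ be real, and let $\delta\in\mathbb{C}$ satisfy $\mathrm{Re}(\delta)>-\frac{\mu n}{2}$. Suppose that $$ \left|\left(\frac{g(z)}{zf'(z)}\right)^{\frac1\mu}-1\right|^{\beta}\left(\mathrm{Re}\left(\delta-1-\frac{zf''(z)}{f'(z)}+\frac{zg'(z)}{g(z)}\right)\right)^{\gamma}<\left(\mathrm{Re}(\delta)+\frac{\mu n}{2}\right)^{\gamma}\qquad\text{for all } z\in\mathbb{U}. $$ Then $$ \left|\left(\frac{g(z)}{zf'(z)}\right)^{\frac1\mu}-1\right|<1\qquad\text{for all } z\in\mathbb{U}, $$ and consequently $f\in\mathcal{STC}(\mu)$.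
   Context: $\mathbb{U}=\{z\in\mathbb{C}:|z|<1\}$ is the open unit disk. For a positive integer $m$, $\mathcal{A}_m$ is the class of functions analytic in $\mathbb{U}$ of the form $f(z)=z+a_{m+1}z^{m+1}+a_{m+2}z^{m+2}+\cdots$; $\mathcal{A}=\mathcal{A}_1$ (which contains every $\mathcal{A}_m$). $\mathcal{S}^{*}$ is the class of functions $g\in\mathcal{A}$ with $\mathrm{Re}\left(\frac{zg'(z)}{g(z)}\right)>0$ for all $z\in\mathbb{U}$ (starlike functions). Quotients such as $zg'(z)/g(z)$, $zf'(z)/g(z)$ and $g(z)/(zf'(z))$ are given their limiting value $1$ at $z=0$; $g$ has no zero in $\mathbb{U}\setminus\{0\}$. For $0<\mu\le1$, $\mathcal{STC}(\mu)$ (strongly close-to-convex functions of order $\mu$) is the class of $f\in\mathcal{A}$ for which there exists $g\in\mathcal{S}^{*}$ with $\mathrm{Re}\left(\left(\frac{zf'(z)}{g(z)}\right)^{1/\mu}\right)>0$ for all $z\in\mathbb{U}$. Conventions: the expressions in the hypothesis are understood to be well defined, so $f'(z)\ne0$ in $\mathbb{U}$. The powers $(g(z)/(zf'(z)))^{1/\mu}$ and $(zf'(z)/g(z))^{1/\mu}$ are the analytic branches in $\mathbb{U}$ with value $1$ at $z=0$. Real powers have their usual meaning, with $x^0=1$ for all real $x$ (including $x=0$); when $\gamma$ is not a nonnegative integer, the hypothesis is understood to require that the real part raised to the power $\gamma$ be nonnegative. *)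

theory Defs
  imports "HOL-Complex_Analysis.Complex_Analysis"
begin

abbreviation unit_disk :: "complex set" where
  "unit_disk \<equiv> ball 0 1"

text \<open>
  Functions on the disk are total functions on \<^typ>\<open>complex\<close>; their values outside the
  disk play no role.
\<close>

definition class_A :: "nat \<Rightarrow> (complex \<Rightarrow> complex) set" where
  "class_A m = {f. f holomorphic_on unit_disk \<and>
     (\<exists>a :: nat \<Rightarrow> complex. \<forall>z\<in>unit_disk.
        (\<lambda>k. a (m + 1 + k) * z ^ (m + 1 + k)) sums (f z - z))}"

text \<open>
  Pointwise quotient of two functions, with the value \<open>1\<close> at the origin; it is only applied
  where the quotient has a removable singularity at \<open>0\<close> with limit \<open>1\<close>.
\<close>

definition quot1 :: "(complex \<Rightarrow> complex) \<Rightarrow> (complex \<Rightarrow> complex) \<Rightarrow> complex \<Rightarrow> complex" where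
  "quot1 u v z = (if z = 0 then 1 else u z / v z)"

text \<open>
  If \<open>g\<close> vanished at some point of the disk other than \<open>0\<close>, the quotient below would be \<open>0\<close>
  there; so the condition on the real part includes that \<open>g\<close> has no such zero.
\<close>

definition starlike_class :: "(complex \<Rightarrow> complex) set" where
  "starlike_class = {g \<in> class_A 1. \<forall>z\<in>unit_disk. Re (quot1 (\<lambda>w. w * deriv g w) g z) > 0}"

text \<open>
  The analytic branch of \<open>h\<^sup>a\<close> on the disk with value \<open>1\<close> at \<open>0\<close>, obtained from the analytic
  logarithm of \<open>h\<close> with value \<open>0\<close> at \<open>0\<close>. It is meaningful for \<open>h\<close> holomorphic and without zeros
  on the disk with \<open>h 0 = 1\<close>; existence and uniqueness for such \<open>h\<close> are shown below.
\<close>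

definition is_disk_log :: "(complex \<Rightarrow> complex) \<Rightarrow> (complex \<Rightarrow> complex) \<Rightarrow> bool" where
  "is_disk_log h L \<longleftrightarrow>
     L holomorphic_on unit_disk \<and> L 0 = 0 \<and> (\<forall>z\<in>unit_disk. exp (L z) = h z)"

definition disk_log :: "(complex \<Rightarrow> complex) \<Rightarrow> complex \<Rightarrow> complex" where
  "disk_log h = (SOME L. is_disk_log h L)"

definition disk_power :: "(complex \<Rightarrow> complex) \<Rightarrow> real \<Rightarrow> complex \<Rightarrow> complex" where
  "disk_power h a z = exp (of_real a * disk_log h z)"

lemma is_disk_log_disk_log:
  assumes "h holomorphic_on unit_disk" "h 0 = 1" "\<And>z. z \<in> unit_disk \<Longrightarrow> h z \<noteq> 0"
  shows "is_disk_log h (disk_log h)"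
proof -
  have "simply_connected unit_disk"
    by (simp add: convex_imp_simply_connected)
  then obtain L where L: "L holomorphic_on unit_disk" "\<And>z. z \<in> unit_disk \<Longrightarrow> h z = exp (L z)"
    using assms simply_connected_eq_holomorphic_log[of unit_disk] by auto
  have "is_disk_log h (\<lambda>z. L z - L 0)"
    unfolding is_disk_log_def using L(1) L(2)[symmetric] assms(2)
    by (auto intro!: holomorphic_intros simp: exp_diff)
  thus ?thesis
    unfolding disk_log_def by (rule someI[of "is_disk_log h"])
qed

lemma is_disk_log_unique:
  assumes "is_disk_log h L" "is_disk_log h M" "z \<in> unit_disk"
  shows "L z = M z"
proof -
  define D where "D = (\<lambda>z. L z - M z)"
  have hol: "D holomorphic_on unit_disk"
    using assms unfolding D_def is_disk_log_def by (auto intro!: holomorphic_intros)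
  have e1: "exp (D w) = 1" if "w \<in> unit_disk" for w
  proof -
    have "exp (L w) = h w" "exp (M w) = h w"
      using assms(1,2) that unfolding is_disk_log_def by blast+
    thus ?thesis
      unfolding D_def exp_diff by (metis divide_self exp_not_eq_zero)
  qed
  have "(D has_field_derivative 0) (at w)" if w: "w \<in> unit_disk" for w
  proof -
    have d: "(D has_field_derivative deriv D w) (at w)"
      using hol w by (simp add: holomorphic_derivI)
    have "((\<lambda>w. exp (D w)) has_field_derivative exp (D w) * deriv D w) (at w)"
      using d by (auto intro!: derivative_eq_intros)
    moreover have "((\<lambda>w. exp (D w)) has_field_derivative 0) (at w)"
      by (rule has_field_derivative_transform_within_open[where S = unit_disk and f = "\<lambda>_. 1"])
         (use e1 w in auto)
    ultimately have "exp (D w) * deriv D w = 0"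
      by (rule DERIV_unique)
    thus ?thesis using d by simp
  qed
  hence "\<exists>c. \<forall>w\<in>unit_disk. D w = c"
    by (intro has_field_derivative_zero_constant) (auto intro: has_field_derivative_at_within)
  hence "D z = D 0"
    using assms(3) by force
  thus ?thesis
    using assms(1,2) by (simp add: D_def is_disk_log_def)
qed

definition strongly_close_to_convex :: "real \<Rightarrow> (complex \<Rightarrow> complex) set" where
  "strongly_close_to_convex \<mu> = {f \<in> class_A 1. (\<forall>z\<in>unit_disk. deriv f z \<noteq> 0) \<and>
     (\<exists>g\<in>starlike_class. \<forall>z\<in>unit_disk.
        Re (disk_power (quot1 (\<lambda>w. w * deriv f w) g) (1 / \<mu>) z) > 0)}"

text \<open>
  Real power with \<open>x\<^sup>0 = 1\<close> for all \<open>x\<close> (in contrast to \<^term>\<open>(0::real) powr 0 = 0\<close>) and with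
  the usual value for negative \<open>x\<close> when the exponent is a natural number. For negative \<open>x\<close> and
  other exponents the value is arbitrary.
\<close>

definition rpow :: "real \<Rightarrow> real \<Rightarrow> real" where
  "rpow x a = (if a \<in> \<nat> then x ^ nat \<lfloor>a\<rfloor> else x powr a)"

end

theory Submission
  imports Defs
begin

text \<open>
  Put \<open>w = (g / (z f'))\<^sup>1\<^sup>/\<^sup>\<mu> - 1\<close>. It vanishes at \<open>0\<close> to order at least \<open>n\<close>, and logarithmic
  differentiation gives \<open>zg'/g - 1 - zf''/f' = \<mu> z w' / (1 + w)\<close>. If \<open>w\<close> left the unit disk, then
  by Jack's lemma there would be a point \<open>z\<close> with \<open>|w z| = 1\<close> and \<open>z w' = k w\<close> for some real
  \<open>k \<ge> n\<close>. Since \<open>Re (w / (1 + w)) = 1/2\<close> whenever \<open>|w| = 1\<close>, the left-hand side of the hypothesis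
  would be at least its right-hand side at this point.
\<close>

section \<open>Normalized power series and the splitting off of powers of \<open>z\<close>\<close>

text \<open>Dividing the series of \<open>f z - z\<close> by \<open>z ^ (m + 1)\<close> leaves a
  power series that converges on the disk; its constant term is the value of \<open>F\<close> at 0.
  One \<open>z\<close> stays outside the bracket so that it cancels later in the quotient of
  \<open>g z\<close> by \<open>z * deriv f z\<close>.\<close>

lemma class_A_factor:
  assumes "f \<in> class_A m"
  obtains F where "F holomorphic_on unit_disk"
    "\<And>z. z \<in> unit_disk \<Longrightarrow> f z = z * (1 + z ^ m * F z)"
proof -
  obtain a where a: "\<And>z. z \<in> unit_disk \<Longrightarrow>
      (\<lambda>k. a (m + 1 + k) * z ^ (m + 1 + k)) sums (f z - z)"
    using assms unfolding class_A_def by blast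
  define F where "F z = (if z = 0 then a (m + 1) else (f z - z) / z ^ (m + 1))" for z
  have "(\<lambda>k. a (m + 1 + k) * (z - 0) ^ k) sums F z" if z: "z \<in> unit_disk" for z
  proof (cases "z = 0")
    case True
    then show ?thesis
      using powser_sums_zero[of "\<lambda>k. a (m + 1 + k)"] by (simp add: F_def)
  next
    case False
    have "(\<lambda>k. a (m + 1 + k) * z ^ (m + 1 + k) / z ^ (m + 1)) sums ((f z - z) / z ^ (m + 1))"
      by (rule sums_divide[OF a[OF z]])
    with False show ?thesis
      by (simp add: F_def power_add)
  qed
  then have "F holomorphic_on unit_disk"
    by (intro power_series_holomorphic[where a = "\<lambda>k. a (m + 1 + k)"]) blast
  moreover have "f z = z * (1 + z ^ m * F z)" if z: "z \<in> unit_disk" for z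
  proof (cases "z = 0")
    case True
    have "(\<lambda>k. 0) sums (f 0 - 0)"
      using a[of 0] by simp
    then have "f 0 = 0"
      using sums_unique2[OF _ sums_zero] by fastforce
    with True show ?thesis
      by simp
  next
    case False
    then have "z ^ (m + 1) * F z = f z - z"
      by (simp add: F_def)
    then show ?thesis
      by (simp add: algebra_simps)
  qed
  ultimately show ?thesis
    using that by blast
qed

text \<open>Zero coefficients fill the gap. This brings \<open>f\<close> and \<open>g\<close> to the
  common index \<open>n\<close>.\<close>

lemma class_A_mono:
  assumes "f \<in> class_A m" "k \<le> m"
  shows "f \<in> class_A k"
proof -
  obtain a where a: "\<And>z. z \<in> unit_disk \<Longrightarrow>
      (\<lambda>i. a (m + 1 + i) * z ^ (m + 1 + i)) sums (f z - z)"
    using assms(1) unfolding class_A_def by blast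
  \<comment> \<open>Only the values \<open>a i\<close> with \<open>i > m\<close> are tied to
    \<open>f\<close>, so the lower ones have to be reset to 0.\<close>
  define b where "b i = (if i \<le> m then 0 else a i)" for i
  have "(\<lambda>i. b (k + 1 + i) * z ^ (k + 1 + i)) sums (f z - z)" if z: "z \<in> unit_disk" for z
  proof -
    let ?u = "\<lambda>i. b (k + 1 + i) * z ^ (k + 1 + i)"
    have "(\<lambda>i. ?u (i + (m - k))) = (\<lambda>i. a (m + 1 + i) * z ^ (m + 1 + i))"
      using assms(2) by (auto simp: b_def algebra_simps)
    then have "(\<lambda>i. ?u (i + (m - k))) sums (f z - z)"
      using a[OF z] by simp
    moreover have "?u i = 0" if "i < m - k" for i
      using that by (simp add: b_def)
    ultimately show ?thesis
      using sums_zero_iff_shift[of "m - k" ?u] by blast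
  qed
  with assms(1) show ?thesis
    unfolding class_A_def by blast
qed

lemma holomorphic_factor_zero:
  assumes "f holomorphic_on A" "open A" "(0::complex) \<in> A" "f 0 = 0"
  obtains u where "u holomorphic_on A" "\<And>z. z \<in> A \<Longrightarrow> f z = z * u z"
proof
  let ?u = "\<lambda>z. if z = 0 then deriv f 0 else (f z - f 0) / (z - 0)"
  show "?u holomorphic_on A"
    using assms by (intro pole_lemma) (auto simp: interior_open)
  show "f z = z * ?u z" if "z \<in> A" for z
    using assms(4) by simp
qed

text \<open>Factors \<open>z\<close> are split off one at a time: if
  \<open>f z = z ^ j * u z\<close> with \<open>j \<le> m\<close>, the form of the derivative forces
  \<open>u 0 = 0\<close>. This serves for functions whose derivative shows a power of
  \<open>z\<close> while their own series is not at hand.\<close>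

lemma holomorphic_factor_of_deriv:
  assumes hol: "f holomorphic_on A" "K holomorphic_on A" and A: "open A" "(0::complex) \<in> A"
    and f0: "f 0 = 0"
    and der: "\<And>z. z \<in> A \<Longrightarrow> deriv f z = z ^ m * K z"
  obtains v where "v holomorphic_on A" "\<And>z. z \<in> A \<Longrightarrow> f z = z ^ Suc m * v z"
proof -
  have "\<exists>u. u holomorphic_on A \<and> (\<forall>z\<in>A. f z = z ^ j * u z)" if "j \<le> Suc m" for j
    using that
  proof (induction j)
    case 0
    then show ?case
      using hol by auto
  next
    case (Suc j)
    then obtain u where u: "u holomorphic_on A" "\<And>z. z \<in> A \<Longrightarrow> f z = z ^ j * u z"
      by auto
    have "u 0 = 0"
    proof (cases j)
      case 0
      then show ?thesis
        using u(2)[of 0] f0 A by simp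
    next
      case (Suc i)
      \<comment> \<open>The product rule for \<open>z ^ j * u z\<close> is compared with
        \<open>z ^ m * K z\<close>, and \<open>z ^ i\<close> is cancelled off the origin.\<close>
      have eq: "of_nat j * u z = z * (z ^ (m - j) * K z - deriv u z)" if z: "z \<in> A" "z \<noteq> 0" for z
      proof -
        have "((\<lambda>z. z ^ j * u z) has_field_derivative
            of_nat j * z ^ i * u z + z ^ j * deriv u z) (at z)"
          using DERIV_mult[OF DERIV_power[OF DERIV_ident, of j] holomorphic_derivI[OF u(1) A(1) z(1)]]
            Suc by (simp add: algebra_simps)
        then have "(f has_field_derivative of_nat j * z ^ i * u z + z ^ j * deriv u z) (at z)"
          by (rule has_field_derivative_transform_within_open[OF _ A(1) z(1)]) (simp add: u(2))
        then have "of_nat j * z ^ i * u z + z ^ j * deriv u z = z ^ m * K z"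
          using der[OF z(1)] DERIV_imp_deriv by metis
        also have "z ^ m = z ^ i * z * z ^ (m - j)"
          using Suc \<open>Suc j \<le> Suc m\<close>
          by (metis Suc_le_mono le_add_diff_inverse power_Suc2 power_add)
        finally have "z ^ i * (of_nat j * u z) = z ^ i * (z * (z ^ (m - j) * K z - deriv u z))"
          using Suc by (simp add: algebra_simps)
        then show ?thesis
          using z(2) by simp
      qed
      \<comment> \<open>Continuity of the difference of the two sides carries the identity to 0,
        where it reads \<open>of_nat j * u 0 = 0\<close>.\<close>
      let ?d = "\<lambda>z. of_nat j * u z - z * (z ^ (m - j) * K z - deriv u z)"
      have "?d holomorphic_on A"
        using u(1) hol(2) A(1) by (intro holomorphic_intros) auto
      then have "isCont ?d 0"
        using A holomorphic_on_imp_continuous_on continuous_on_eq_continuous_at by blast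
      then have "?d \<midarrow>0\<rightarrow> ?d 0"
        by (simp only: isCont_def)
      moreover have "?d \<midarrow>0\<rightarrow> 0"
      proof (rule tendsto_eventually)
        show "\<forall>\<^sub>F z in at 0. ?d z = 0"
          using A eq by (auto simp: eventually_at_topological)
      qed
      ultimately have "?d 0 = 0"
        by (rule LIM_unique)
      then show ?thesis
        using Suc by (simp del: of_nat_Suc)
    qed
    then obtain v where "v holomorphic_on A" "\<And>z. z \<in> A \<Longrightarrow> u z = z * v z"
      using holomorphic_factor_zero[OF u(1) A] by blast
    then show ?case
      using u(2) by (intro exI[of _ v]) (simp add: mult_ac)
  qed
  from this[of "Suc m"] show ?thesis
    using that by auto
qed

section \<open>The first exit from the unit disk and Jack's lemma\<close>

text \<open>A point of least modulus is taken among those with \<open>1 \<le> cmod (w z)\<close>;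
  cutting this set down to the closed disk of radius \<open>cmod z1\<close> makes it compact. At
  smaller modulus \<open>w\<close> is below 1, and continuity extends the bound to the bounding
  circle.\<close>

lemma first_exit_point:
  assumes hol: "w holomorphic_on ball 0 R" and w0: "cmod (w 0) < 1"
    and z1: "z1 \<in> ball 0 R" "cmod (w z1) \<ge> 1"
  obtains z0 where "z0 \<in> ball 0 R" "z0 \<noteq> 0" "cmod (w z0) = 1"
    "\<And>z. cmod z \<le> cmod z0 \<Longrightarrow> cmod (w z) \<le> 1"
proof -
  have cont: "continuous_on (cball 0 r) w" if "r < R" for r
    using holomorphic_on_imp_continuous_on[OF hol] that
    by (rule_tac continuous_on_subset) auto
  define S where "S = {z \<in> cball 0 (cmod z1). 1 \<le> cmod (w z)}"
  have "closed S"
    unfolding S_def using z1(1)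
    by (intro continuous_on_closed_Collect_le continuous_intros cont) auto
  moreover have "bounded S"
    unfolding S_def by (rule bounded_subset[OF bounded_cball[of 0 "cmod z1"]]) auto
  ultimately have "compact S"
    by (simp add: compact_eq_bounded_closed)
  moreover have "S \<noteq> {}"
    using z1 by (auto simp: S_def)
  ultimately obtain z0 where z0: "z0 \<in> S" "\<And>z. z \<in> S \<Longrightarrow> cmod z0 \<le> cmod z"
    using continuous_attains_inf[of S cmod] by (auto intro: continuous_intros)
  have R: "cmod z0 < R" "cmod z0 \<le> cmod z1"
    using z0(1) z1(1) by (auto simp: S_def)
  have ne: "z0 \<noteq> 0"
    using z0(1) w0 by (auto simp: S_def)
  have "\<forall>z\<in>ball 0 (cmod z0). cmod (w z) \<le> 1"
  proof
    fix z :: complex assume z: "z \<in> ball 0 (cmod z0)"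
    then have "z \<notin> S"
      using z0(2)[of z] by auto
    with z R show "cmod (w z) \<le> 1"
      by (auto simp: S_def)
  qed
  \<comment> \<open>As \<open>z0\<close> is not 0, the closed disk is the closure of the open disk
    of radius \<open>cmod z0\<close>.\<close>
  then have le: "cmod (w z) \<le> 1" if "cmod z \<le> cmod z0" for z
    using that ne R(1)
    by (intro continuous_on_closure_norm_le[of "ball 0 (cmod z0)"]) (auto intro: cont)
  moreover have "cmod (w z0) = 1"
    using z0(1) le[of z0] by (simp add: S_def)
  ultimately show ?thesis
    using that[of z0] R ne by auto
qed

lemma has_real_derivative_cmod_sq:
  assumes "(u has_vector_derivative u') (at t)"
  shows "((\<lambda>t. (cmod (u t))\<^sup>2) has_real_derivative 2 * Re (cnj (u t) * u')) (at t)"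
proof -
  have "((\<lambda>t. (Re (u t))\<^sup>2 + (Im (u t))\<^sup>2) has_real_derivative
      2 * Re (u t) * Re u' + 2 * Im (u t) * Im u') (at t)"
    using DERIV_add[OF DERIV_power[OF has_field_derivative_Re[OF assms], of 2]
      DERIV_power[OF has_field_derivative_Im[OF assms], of 2]]
    by (simp add: algebra_simps)
  then show ?thesis
    by (simp add: cmod_power2 algebra_simps)
qed

text \<open>
  The tangential derivative of \<open>|w|\<^sup>2\<close> at the maximum point \<open>z0\<close> is zero, so \<open>z0 w' / w\<close> is real;
  the radial derivative is compared with that of \<open>t ^ (2 * n)\<close>, which dominates \<open>|w (t z0)|\<^sup>2\<close>.
\<close>

lemma Jack_lemma:
  assumes hol: "v holomorphic_on ball 0 R"
    and w: "\<And>z. z \<in> ball 0 R \<Longrightarrow> w z = z ^ n * v z"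
    and z0: "z0 \<in> ball 0 R" "z0 \<noteq> 0" "cmod (w z0) = 1"
    and le: "\<And>z. cmod z \<le> cmod z0 \<Longrightarrow> cmod (w z) \<le> 1"
  obtains k :: real where "k \<ge> real n" "z0 * deriv w z0 = of_real k * w z0"
proof -
  \<comment> \<open>Since \<open>cmod (w z0) = 1\<close>, \<open>X\<close> equals
    \<open>z0 * deriv w z0 / w z0\<close>; once shown to be real, it is the multiplier
    \<open>k\<close>.\<close>
  define X where "X = cnj (w z0) * (z0 * deriv w z0)"
  have "(\<lambda>z. z ^ n * v z) holomorphic_on ball 0 R"
    using hol by (intro holomorphic_intros)
  then have "w holomorphic_on ball 0 R"
    by (rule holomorphic_transform) (simp add: w)
  then have dw: "(w has_field_derivative deriv w z0) (at z0)"
    using z0(1) holomorphic_derivI open_ball by blast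

  have "Im X = 0"
  proof -
    \<comment> \<open>This path runs along the circle through \<open>z0\<close>; its velocity
      \<open>z0 * \<i>\<close> turns the real part in the derivative formula into
      \<open>- Im X\<close>.\<close>
    have "((\<lambda>t. z0 * cis t) has_vector_derivative z0 * \<i>) (at 0)"
      unfolding cis_conv_exp
      by (rule has_vector_derivative_real_field) (auto intro!: derivative_eq_intros)
    from field_vector_diff_chain_at[OF this, of w "deriv w z0"] dw
    have "((w \<circ> (\<lambda>t. z0 * cis t)) has_vector_derivative z0 * \<i> * deriv w z0) (at 0)"
      by simp
    from has_real_derivative_cmod_sq[OF this]
    have "((\<lambda>t. (cmod (w (z0 * cis t)))\<^sup>2) has_real_derivative - 2 * Im X) (at 0)"
      by (simp add: X_def algebra_simps)
    moreover have "(cmod (w (z0 * cis t)))\<^sup>2 \<le> (cmod (w (z0 * cis 0)))\<^sup>2" for t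
      using le[of "z0 * cis t"] z0(3) by (simp add: norm_mult power_le_one)
    ultimately have "- 2 * Im X = 0"
      by (intro DERIV_local_max[of "\<lambda>t. (cmod (w (z0 * cis t)))\<^sup>2" _ 0 1]) auto
    then show ?thesis
      by simp
  qed
  moreover have "Re X \<ge> real n"
  proof (rule ccontr)
    let ?r = "cmod z0"
    let ?D = "\<lambda>t::real. (cmod (w (of_real t * z0)))\<^sup>2 - t ^ (2 * n)"
    assume less: "\<not> Re X \<ge> real n"
    have r: "0 < ?r" "?r < R"
      using z0 by auto
    \<comment> \<open>Maximum modulus, applied to \<open>v\<close> instead of \<open>w\<close>,
      gives a Schwarz-type bound; it yields
      \<open>cmod (w (of_real t * z0)) \<le> t ^ n\<close>.\<close>
    have vle: "cmod (v z) \<le> 1 / ?r ^ n" if z: "cmod z \<le> ?r" for z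
    proof (rule maximum_modulus_frontier[of v "cball 0 ?r"])
      show "v holomorphic_on interior (cball 0 ?r)"
        using hol r by (auto intro: holomorphic_on_subset)
      show "continuous_on (closure (cball 0 ?r)) v"
        using r by (auto intro: continuous_on_subset[OF holomorphic_on_imp_continuous_on[OF hol]])
      show "cmod (v y) \<le> 1 / ?r ^ n" if "y \<in> frontier (cball 0 ?r)" for y
      proof -
        have y: "cmod y = ?r"
          using that by simp
        then have "?r ^ n * cmod (v y) = cmod (w y)"
          using r by (simp add: w norm_mult norm_power)
        also have "\<dots> \<le> 1"
          using le y by simp
        finally show ?thesis
          using r by (simp add: field_simps)
      qed
    qed (use z in auto)
    have D: "?D t \<le> 0" if t: "0 \<le> t" "t \<le> 1" for t
    proof -
      have tr: "t * ?r \<le> ?r"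
        using t by (simp add: mult_left_le_one_le)
      then have "t * ?r < R"
        using r(2) by (rule le_less_trans)
      with t have "of_real t * z0 \<in> ball 0 R"
        by (simp add: norm_mult)
      then have "cmod (w (of_real t * z0)) = (t * ?r) ^ n * cmod (v (of_real t * z0))"
        using t by (simp only: w norm_mult norm_power norm_of_real abs_of_nonneg)
      also have "\<dots> \<le> (t * ?r) ^ n * (1 / ?r ^ n)"
        using t tr r by (intro mult_left_mono vle) (auto simp: norm_mult)
      also have "\<dots> = t ^ n"
        using r by (simp add: power_mult_distrib)
      finally have "(cmod (w (of_real t * z0)))\<^sup>2 \<le> (t ^ n)\<^sup>2"
        by (intro power_mono) auto
      then show ?thesis
        by (simp add: power_mult[symmetric] mult.commute)
    qed
    have "((\<lambda>t. of_real t * z0) has_vector_derivative z0) (at 1)"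
      by (auto intro!: derivative_eq_intros)
    from field_vector_diff_chain_at[OF this, of w "deriv w z0"] dw
    have "((w \<circ> (\<lambda>t. of_real t * z0)) has_vector_derivative z0 * deriv w z0) (at 1)"
      by simp
    from has_real_derivative_cmod_sq[OF this]
    have "((\<lambda>t. (cmod (w (of_real t * z0)))\<^sup>2) has_real_derivative 2 * Re X) (at 1)"
      by (simp add: X_def o_def)
    from DERIV_diff[OF this DERIV_power[OF DERIV_ident, of "2 * n"]]
    have "(?D has_real_derivative 2 * Re X - 2 * real n) (at 1)"
      by simp
    \<comment> \<open>A negative derivative at 1 would make \<open>?D\<close> exceed
      \<open>?D 1 = 0\<close> just to the left of 1, against \<open>?D t \<le> 0\<close>
      there.\<close>
    then obtain d where d: "d > 0" "\<And>h. h > 0 \<Longrightarrow> h < d \<Longrightarrow> ?D 1 < ?D (1 - h)"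
      using has_real_derivative_neg_dec_left[of ?D "2 * Re X - 2 * real n" 1 UNIV] less by auto
    \<comment> \<open>The minimum keeps the step below \<open>d\<close> and the new point in the
      unit interval.\<close>
    have "?D 1 < ?D (1 - min (d / 2) (1 / 2))"
      using d(1) by (intro d(2)) auto
    moreover have "?D 1 = 0"
      using z0(3) by simp
    moreover have "?D (1 - min (d / 2) (1 / 2)) \<le> 0"
      using d(1) by (intro D) auto
    ultimately show False
      by linarith
  qed
  moreover have "z0 * deriv w z0 = X * w z0"
  proof -
    have "w z0 * cnj (w z0) = 1"
      using z0(3) complex_norm_square[of "w z0"] by simp
    then show ?thesis
      unfolding X_def by (metis mult.assoc mult.commute mult_1)
  qed
  moreover from \<open>Im X = 0\<close> have "X = of_real (Re X)"
    by (simp add: complex_eq_iff)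
  ultimately show ?thesis
    using that by metis
qed

section \<open>The map \<open>z / (1 + z)\<close> on the unit circle, and real powers\<close>

text \<open>On the unit circle \<open>z * cnj (1 + z)\<close> has real part \<open>1 + Re z\<close>,
  and the square of \<open>cmod (1 + z)\<close> is \<open>2 * (1 + Re z)\<close>.\<close>

lemma Re_divide_one_plus:
  assumes "cmod z = 1" "1 + z \<noteq> 0"
  shows "Re (z / (1 + z)) = 1 / 2"
proof -
  have 1: "(Re z)\<^sup>2 + (Im z)\<^sup>2 = 1"
    using assms(1) cmod_power2[of z] by simp
  have "(1 + Re z)\<^sup>2 + (Im z)\<^sup>2 \<noteq> 0"
    using assms(2) by (auto simp: complex_eq_iff sum_power2_eq_zero_iff)
  with 1 show ?thesis
    by (simp add: Re_divide field_simps power2_eq_square)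
qed

lemma rpow_one [simp]: "rpow 1 a = 1"
  by (simp add: rpow_def)

lemma rpow_mono:
  assumes "0 < x" "x \<le> y" "0 \<le> a"
  shows "rpow x a \<le> rpow y a"
  using assms by (auto simp: rpow_def intro: power_mono powr_mono2)

section \<open>Expansion of the quotient of \<open>g\<close> by \<open>z f'\<close> at the
  origin\<close>

lemma starlike_nonzero:
  assumes "g \<in> starlike_class" "z \<in> unit_disk" "z \<noteq> 0"
  shows "g z \<noteq> 0"
proof -
  have "Re (quot1 (\<lambda>w. w * deriv g w) g z) > 0"
    using assms by (simp add: starlike_class_def)
  with assms(3) show ?thesis
    by (auto simp: quot1_def)
qed

lemma class_A_deriv_factor:
  assumes "f \<in> class_A m"
  obtains F where "F holomorphic_on unit_disk"
    "\<And>z. z \<in> unit_disk \<Longrightarrow> deriv f z = 1 + z ^ m * F z"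
proof -
  obtain F where F: "F holomorphic_on unit_disk"
    "\<And>z. z \<in> unit_disk \<Longrightarrow> f z = z * (1 + z ^ m * F z)"
    using class_A_factor[OF assms] by blast
  have "deriv f z = 1 + z ^ m * (of_nat (m + 1) * F z + z * deriv F z)" if z: "z \<in> unit_disk" for z
  proof (rule DERIV_imp_deriv)
    have "((\<lambda>z. z + z ^ Suc m * F z) has_field_derivative
        1 + (z ^ Suc m * deriv F z + of_nat (Suc m) * z ^ m * F z)) (at z)"
      using DERIV_add[OF DERIV_ident DERIV_mult[OF DERIV_power[OF DERIV_ident, of "Suc m"]
        holomorphic_derivI[OF F(1) open_ball z]]] by (simp add: algebra_simps)
    then have "(f has_field_derivative
        1 + (z ^ Suc m * deriv F z + of_nat (Suc m) * z ^ m * F z)) (at z)"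
      by (rule has_field_derivative_transform_within_open[OF _ open_ball z])
        (simp add: F(2) algebra_simps)
    then show "(f has_field_derivative
        1 + z ^ m * (of_nat (m + 1) * F z + z * deriv F z)) (at z)"
      by (simp add: algebra_simps)
  qed
  moreover have "(\<lambda>z. of_nat (m + 1) * F z + z * deriv F z) holomorphic_on unit_disk"
    using F(1) by (intro holomorphic_intros) auto
  ultimately show ?thesis
    using that by blast
qed

text \<open>After \<open>z\<close> cancels, numerator and denominator both have the form 1 plus a
  multiple of \<open>z ^ n\<close>, so the quotient differs from 1 by
  \<open>z ^ n * (G z - F z)\<close> over the denominator, which is \<open>deriv f z\<close> and has
  no zero. At 0 this matches the value 1 of \<open>quot1\<close> because
  \<open>n > 0\<close>.\<close>

lemma quot1_factor:
  assumes "f \<in> class_A m1" "g \<in> class_A m2" "n \<le> m1" "n \<le> m2" "n > 0"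
    and nz: "\<And>z. z \<in> unit_disk \<Longrightarrow> deriv f z \<noteq> 0"
  obtains H where "H holomorphic_on unit_disk"
    "\<And>z. z \<in> unit_disk \<Longrightarrow> quot1 g (\<lambda>w. w * deriv f w) z = 1 + z ^ n * H z"
proof -
  obtain F where F: "F holomorphic_on unit_disk"
    "\<And>z. z \<in> unit_disk \<Longrightarrow> deriv f z = 1 + z ^ n * F z"
    using class_A_deriv_factor[OF class_A_mono] assms(1,3) by blast
  obtain G where G: "G holomorphic_on unit_disk"
    "\<And>z. z \<in> unit_disk \<Longrightarrow> g z = z * (1 + z ^ n * G z)"
    using class_A_factor[OF class_A_mono] assms(2,4) by blast
  have nz': "1 + z ^ n * F z \<noteq> 0" if "z \<in> unit_disk" for z
    using nz[OF that] F(2)[OF that] by simp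
  have "(\<lambda>z. (G z - F z) / (1 + z ^ n * F z)) holomorphic_on unit_disk"
    using F(1) G(1) nz' by (intro holomorphic_intros) auto
  moreover have "quot1 g (\<lambda>w. w * deriv f w) z = 1 + z ^ n * ((G z - F z) / (1 + z ^ n * F z))"
    if "z \<in> unit_disk" for z
  proof (cases "z = 0")
    case True
    with \<open>n > 0\<close> show ?thesis
      by (simp add: quot1_def)
  next
    case False
    then have "quot1 g (\<lambda>w. w * deriv f w) z = (1 + z ^ n * G z) / (1 + z ^ n * F z)"
      using F(2)[OF that] G(2)[OF that] by (simp add: quot1_def)
    then show ?thesis
      using nz'[OF that] by (simp add: divide_simps) (simp add: algebra_simps)
  qed
  ultimately show ?thesis
    using that by blast
qed

section \<open>Analytic powers on the disk\<close>

context
  fixes h :: "complex \<Rightarrow> complex"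
  assumes hol: "h holomorphic_on unit_disk" and h0: "h 0 = 1"
    and nz: "\<And>z. z \<in> unit_disk \<Longrightarrow> h z \<noteq> 0"
begin

text \<open>Differentiating \<open>exp (L w) = h w\<close> shows that the logarithm has derivative
  \<open>deriv h z / h z\<close>; the chain rule does the rest.\<close>

lemma has_field_derivative_disk_power:
  assumes z: "z \<in> unit_disk"
  shows "(disk_power h a has_field_derivative
    of_real a * disk_power h a z * (deriv h z / h z)) (at z)"
proof -
  let ?L = "disk_log h"
  have L: "?L holomorphic_on unit_disk" "\<And>w. w \<in> unit_disk \<Longrightarrow> exp (?L w) = h w"
    using is_disk_log_disk_log[OF hol h0 nz] by (auto simp: is_disk_log_def)
  have dL: "(?L has_field_derivative deriv ?L z) (at z)"
    using L(1) z holomorphic_derivI by blast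
  then have "((\<lambda>w. exp (?L w)) has_field_derivative exp (?L z) * deriv ?L z) (at z)"
    by (auto intro!: derivative_eq_intros)
  then have "(h has_field_derivative exp (?L z) * deriv ?L z) (at z)"
    by (rule has_field_derivative_transform_within_open[OF _ open_ball z]) (simp add: L(2))
  then have "deriv h z = h z * deriv ?L z"
    using DERIV_imp_deriv L(2)[OF z] by metis
  then have "deriv ?L z = deriv h z / h z"
    using nz[OF z] by simp
  with dL have "((\<lambda>w. exp (of_real a * ?L w)) has_field_derivative
      of_real a * exp (of_real a * ?L z) * (deriv h z / h z)) (at z)"
    by (auto intro!: derivative_eq_intros)
  then show ?thesis
    by (simp add: disk_power_def[abs_def])
qed

lemma holomorphic_on_disk_power: "disk_power h a holomorphic_on unit_disk"
  using has_field_derivative_disk_power[of _ a] holomorphic_on_open[OF open_ball] by blast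

lemma disk_power_0: "disk_power h a 0 = 1"
  using is_disk_log_disk_log[OF hol h0 nz] by (simp add: disk_power_def is_disk_log_def)

text \<open>The negative of the normalized logarithm of \<open>h\<close> is a normalized logarithm
  of the reciprocal; uniqueness identifies it with the chosen one.\<close>

lemma disk_power_inverse:
  assumes "z \<in> unit_disk"
  shows "disk_power (\<lambda>z. inverse (h z)) a z = inverse (disk_power h a z)"
proof -
  have "is_disk_log (\<lambda>z. inverse (h z)) (\<lambda>z. - disk_log h z)"
    using is_disk_log_disk_log[OF hol h0 nz]
    by (auto simp: is_disk_log_def exp_minus intro!: holomorphic_intros)
  moreover have "is_disk_log (\<lambda>z. inverse (h z)) (disk_log (\<lambda>z. inverse (h z)))"
    using hol h0 nz by (intro is_disk_log_disk_log) (auto intro!: holomorphic_intros)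
  ultimately show ?thesis
    using assms is_disk_log_unique[of "\<lambda>z. inverse (h z)"]
    by (metis disk_power_def exp_minus mult_minus_right)
qed

text \<open>Supplies the factor \<open>z ^ n\<close> that Jack's lemma asks of \<open>w\<close>. The
  derivative of \<open>h\<close> has the factor \<open>z ^ (n - 1)\<close>, hence so does that of
  the power; vanishing at 0 raises the order by one.\<close>

lemma disk_power_minus_one_factor:
  assumes H: "H holomorphic_on unit_disk" "\<And>z. z \<in> unit_disk \<Longrightarrow> h z = 1 + z ^ n * H z"
    and n: "n > 0"
  obtains v where "v holomorphic_on unit_disk"
    "\<And>z. z \<in> unit_disk \<Longrightarrow> disk_power h a z - 1 = z ^ n * v z"
proof -
  obtain m where m: "n = Suc m"
    using n gr0_conv_Suc by blast
  define K where
    "K z = of_real a * disk_power h a z * ((of_nat n * H z + z * deriv H z) / h z)" for z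
  have dh: "deriv h z = z ^ m * (of_nat n * H z + z * deriv H z)" if z: "z \<in> unit_disk" for z
  proof (rule DERIV_imp_deriv)
    have "((\<lambda>z. 1 + z ^ n * H z) has_field_derivative
        z ^ m * (of_nat n * H z + z * deriv H z)) (at z)"
      using DERIV_add[OF DERIV_const[of 1] DERIV_mult[OF DERIV_power[OF DERIV_ident, of n]
        holomorphic_derivI[OF H(1) open_ball z]]] by (simp add: m algebra_simps)
    then show "(h has_field_derivative z ^ m * (of_nat n * H z + z * deriv H z)) (at z)"
      by (rule has_field_derivative_transform_within_open[OF _ open_ball z]) (simp add: H(2))
  qed
  have "K holomorphic_on unit_disk"
    unfolding K_def using hol H(1) nz
    by (intro holomorphic_intros holomorphic_on_disk_power) auto
  moreover have "(\<lambda>z. disk_power h a z - 1) holomorphic_on unit_disk"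
    by (intro holomorphic_intros holomorphic_on_disk_power)
  moreover have "deriv (\<lambda>z. disk_power h a z - 1) z = z ^ m * K z" if z: "z \<in> unit_disk" for z
  proof (rule DERIV_imp_deriv)
    show "((\<lambda>z. disk_power h a z - 1) has_field_derivative z ^ m * K z) (at z)"
      using DERIV_diff[OF has_field_derivative_disk_power[OF z] DERIV_const[of 1]]
      by (simp add: K_def dh[OF z] mult_ac)
  qed
  ultimately obtain v where "v holomorphic_on unit_disk"
    "\<And>z. z \<in> unit_disk \<Longrightarrow> disk_power h a z - 1 = z ^ Suc m * v z"
    using holomorphic_factor_of_deriv[of "\<lambda>z. disk_power h a z - 1" unit_disk K m]
    by (auto simp: disk_power_0)
  with m show ?thesis
    using that by blast
qed

end

section \<open>The logarithmic derivative and the bound on \<open>w\<close>\<close>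

text \<open>Links the real part in the hypothesis to \<open>h\<close>. Near a point other than 0,
  \<open>h\<close> is the plain quotient, so the quotient rule applies.\<close>

lemma quot1_log_deriv:
  assumes f: "f holomorphic_on unit_disk" and g: "g holomorphic_on unit_disk"
    and z: "z \<in> unit_disk" "z \<noteq> 0" and nz: "deriv f z \<noteq> 0" "g z \<noteq> 0"
  defines "h \<equiv> quot1 g (\<lambda>w. w * deriv f w)"
  shows "z * (deriv h z / h z) = z * deriv g z / g z - 1 - z * deriv (deriv f) z / deriv f z"
proof -
  have "(deriv f has_field_derivative deriv (deriv f) z) (at z)"
    using f z(1) by (intro holomorphic_derivI[of _ unit_disk] holomorphic_deriv) auto
  moreover have "(g has_field_derivative deriv g z) (at z)"
    using g z(1) by (intro holomorphic_derivI[of _ unit_disk]) auto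
  ultimately have "((\<lambda>w. g w / (w * deriv f w)) has_field_derivative
      (deriv g z * (z * deriv f z) - g z * (deriv f z + z * deriv (deriv f) z)) /
      ((z * deriv f z) * (z * deriv f z))) (at z)"
    using z(2) nz by (auto intro!: derivative_eq_intros simp: algebra_simps)
  then have "(h has_field_derivative
      (deriv g z * (z * deriv f z) - g z * (deriv f z + z * deriv (deriv f) z)) /
      ((z * deriv f z) * (z * deriv f z))) (at z)"
    by (rule has_field_derivative_transform_within_open[where S = "- {0}"])
      (use z(2) in \<open>auto simp: h_def quot1_def\<close>)
  then have "deriv h z = (deriv g z * (z * deriv f z) - g z * (deriv f z + z * deriv (deriv f) z)) /
      ((z * deriv f z) * (z * deriv f z))"
    by (rule DERIV_imp_deriv)
  then show ?thesis
    using z(2) nz by (simp add: h_def quot1_def divide_simps) (simp add: algebra_simps)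
qed

theorem theorem4:
  fixes n1 n2 n :: nat
    and f g :: "complex \<Rightarrow> complex"
    and \<beta> \<gamma> \<mu> :: real
    and \<delta> :: complex
  assumes "n1 > 0" and "n2 > 0" and "n = min n1 n2"
    and "f \<in> class_A n1"
    and "g \<in> class_A n2 \<inter> starlike_class"
    and "\<beta> \<ge> 0" and "\<gamma> \<ge> 0" and "\<beta> + \<gamma> > 0"
    and "0 < \<mu>" and "\<mu> \<le> 1"
    and "Re \<delta> > - (\<mu> * real n / 2)"
    and "\<forall>z\<in>unit_disk. deriv f z \<noteq> 0"
    and "\<gamma> \<notin> \<nat> \<longrightarrow> (\<forall>z\<in>unit_disk.
           Re (\<delta> - 1 - z * deriv (deriv f) z / deriv f z + quot1 (\<lambda>w. w * deriv g w) g z) \<ge> 0)"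
    and "\<forall>z\<in>unit_disk.
           rpow (cmod (disk_power (quot1 g (\<lambda>w. w * deriv f w)) (1 / \<mu>) z - 1)) \<beta> *
           rpow (Re (\<delta> - 1 - z * deriv (deriv f) z / deriv f z
                       + quot1 (\<lambda>w. w * deriv g w) g z)) \<gamma>
           < rpow (Re \<delta> + \<mu> * real n / 2) \<gamma>"
  shows "(\<forall>z\<in>unit_disk. cmod (disk_power (quot1 g (\<lambda>w. w * deriv f w)) (1 / \<mu>) z - 1) < 1)
         \<and> f \<in> strongly_close_to_convex \<mu>"
proof -
  define h where "h = quot1 g (\<lambda>w. w * deriv f w)"
  define w where "w z = disk_power h (1 / \<mu>) z - 1" for z
  have n: "n > 0" "n \<le> n1" "n \<le> n2"
    using assms(1-3) by auto
  have f: "f holomorphic_on unit_disk" and g: "g holomorphic_on unit_disk"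
    using assms(4,5) by (auto simp: class_A_def)
  have g_nz: "g z \<noteq> 0" if "z \<in> unit_disk" "z \<noteq> 0" for z
    using starlike_nonzero assms(5) that by blast
  obtain H where H: "H holomorphic_on unit_disk"
    "\<And>z. z \<in> unit_disk \<Longrightarrow> h z = 1 + z ^ n * H z"
    unfolding h_def using quot1_factor[of f n1 g n2 n] assms(4,5,12) n by blast
  have hol: "h holomorphic_on unit_disk"
  proof (rule holomorphic_transform)
    show "(\<lambda>z. 1 + z ^ n * H z) holomorphic_on unit_disk"
      using H(1) by (intro holomorphic_intros)
  qed (simp add: H(2))
  have h0: "h 0 = 1"
    by (simp add: h_def quot1_def)
  have nz: "h z \<noteq> 0" if "z \<in> unit_disk" for z
    using g_nz assms(12) that by (simp add: h_def quot1_def)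
  obtain v where v: "v holomorphic_on unit_disk" "\<And>z. z \<in> unit_disk \<Longrightarrow> w z = z ^ n * v z"
    unfolding w_def using disk_power_minus_one_factor[OF hol h0 nz H n(1)] by blast
  \<comment> \<open>By definition \<open>1 + w z\<close> is an exponential.\<close>
  have w1: "1 + w z \<noteq> 0" for z
    by (simp add: w_def disk_power_def)
  have bound: "cmod (w z) < 1" if z: "z \<in> unit_disk" for z
  proof (rule ccontr)
    assume "\<not> cmod (w z) < 1"
    moreover have "w holomorphic_on unit_disk"
      unfolding w_def[abs_def]
      by (intro holomorphic_intros holomorphic_on_disk_power hol h0 nz)
    moreover have "w 0 = 0"
      using v(2)[of 0] n(1) by simp
    ultimately obtain z0 where z0: "z0 \<in> unit_disk" "z0 \<noteq> 0" "cmod (w z0) = 1"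
      "\<And>z. cmod z \<le> cmod z0 \<Longrightarrow> cmod (w z) \<le> 1"
      using first_exit_point[of w 1 z] z by auto
    obtain k where k: "k \<ge> real n" "z0 * deriv w z0 = of_real k * w z0"
      using Jack_lemma[OF v z0] by blast
    \<comment> \<open>\<open>E\<close> is the argument of \<open>Re\<close> in the hypothesis at
      \<open>z0\<close>; \<open>E - \<delta>\<close> is \<open>z0\<close> times the logarithmic
      derivative of \<open>h\<close>.\<close>
    define E where "E = \<delta> - 1 - z0 * deriv (deriv f) z0 / deriv f z0
                       + quot1 (\<lambda>w. w * deriv g w) g z0"
    have "(w has_field_derivative
        of_real (1 / \<mu>) * disk_power h (1 / \<mu>) z0 * (deriv h z0 / h z0)) (at z0)"
      unfolding w_def[abs_def]
      using DERIV_diff[OF has_field_derivative_disk_power[OF hol h0 nz z0(1), of "1 / \<mu>"]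
        DERIV_const[of 1]] by simp
    then have "deriv w z0 = of_real (1 / \<mu>) * (1 + w z0) * (deriv h z0 / h z0)"
      using DERIV_imp_deriv by (fastforce simp: w_def)
    then have "of_real \<mu> * (z0 * deriv w z0) = (1 + w z0) * (z0 * (deriv h z0 / h z0))"
      using assms(9) by simp
    then have "z0 * (deriv h z0 / h z0) = of_real \<mu> * (of_real k * w z0) / (1 + w z0)"
      unfolding k(2) by (subst eq_divide_eq) (use w1 in \<open>simp add: mult.commute\<close>)
    then have "z0 * (deriv h z0 / h z0) = of_real (\<mu> * k) * (w z0 / (1 + w z0))"
      by simp
    moreover have "E = \<delta> + z0 * (deriv h z0 / h z0)"
      unfolding h_def E_def using quot1_log_deriv[OF f g z0(1,2)] assms(12) g_nz z0(1,2)
      by (simp add: quot1_def)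
    ultimately have "Re E = Re \<delta> + \<mu> * k * Re (w z0 / (1 + w z0))"
      by (simp only: plus_complex.sel Re_complex_of_real times_complex.sel Im_complex_of_real)
    also have "\<dots> = Re \<delta> + \<mu> * k / 2"
      using Re_divide_one_plus[OF z0(3) w1] by simp
    finally have "Re E \<ge> Re \<delta> + \<mu> * real n / 2"
      using k(1) assms(9) by simp
    moreover have "rpow (cmod (w z0)) \<beta> * rpow (Re E) \<gamma> < rpow (Re \<delta> + \<mu> * real n / 2) \<gamma>"
      using assms(14) z0(1) by (simp add: E_def w_def h_def)
    \<comment> \<open>The first factor is \<open>rpow 1 \<beta> = 1\<close>, and monotonicity from
      the positive base \<open>Re \<delta> + \<mu> * real n / 2\<close> makes the second at least
      the right-hand side.\<close>
    ultimately show False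
      using rpow_mono[of "Re \<delta> + \<mu> * real n / 2" "Re E" \<gamma>] assms(7,11) z0(3) by simp
  qed
  \<comment> \<open>This is an equality of total functions: both sides are 1 at 0, and elsewhere the
    convention that division by 0 gives 0 covers any zeros.\<close>
  have inv: "quot1 (\<lambda>w. w * deriv f w) g = (\<lambda>z. inverse (h z))"
    by (auto simp: h_def quot1_def)
  have "Re (disk_power (quot1 (\<lambda>w. w * deriv f w) g) (1 / \<mu>) z) > 0" if z: "z \<in> unit_disk" for z
  proof -
    let ?p = "disk_power h (1 / \<mu>) z"
    \<comment> \<open>The bound puts \<open>1 + w z\<close> in the right half-plane, which inversion
      preserves.\<close>
    have "\<bar>Re (w z)\<bar> < 1"
      using bound[OF z] abs_Re_le_cmod[of "w z"] by linarith
    then have "Re ?p > 0"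
      by (simp add: w_def)
    then have "Re (inverse ?p) > 0"
      by (simp add: Re_divide inverse_eq_divide sum_power2_gt_zero_iff)
    then show ?thesis
      unfolding inv using disk_power_inverse[OF hol h0 nz z] by simp
  qed
  moreover have "f \<in> class_A 1"
    using class_A_mono assms(1,4) by (metis One_nat_def Suc_leI)
  ultimately have "f \<in> strongly_close_to_convex \<mu>"
    using assms(5,12) unfolding strongly_close_to_convex_def by blast
  then show ?thesis
    using bound by (auto simp: w_def h_def)
qed

end
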